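(* Let $X$ be a nonempty finite set, let $g:X\to X$ satisfy $g^2=g$, and let $*_g$ be the operation $a*_gb=g(b)$. Let $d$ be an integer and consider the chain complex $C^{(d)}_n(X)=\mathbb Z X^{n+1}$ ($n\ge 0$) with boundary $\partial^{(d)}=d\,\partial^{( *_g)}$; let $H_n^{(d)}(X)$ and $\tilde H_n^{(d)}(X)$ be its homology and augmented homology. (i) If $d\ne0$ then for every $n\ge0$ $$\tilde H_n^{(d)}(X)\cong\mathbb Z^{(|g(X)|-1)|X|^n}\oplus\mathbb Z_d^{|X|^{n+1}-|g(X)|u_n},$$ where $u_n=|X|^n-|X|^{n-1}+\dots+(-1)^{n-1}|X|+(-1)^n$. In particular, if $g=\mathrm{Id}$, then $$\tilde H_n^{(d)}(X)\cong\mathbb Z^{(|X|-1)|X|^n}\oplus\mathbb Z_d^{u_n-(-1)^n}.$$ (ii) If $d=0$, then $H_n^{(d)}(X)=C_n^{(d)}(X)\cong\mathbb Z^{|X|^{n+1}}$ for every $n\ge0$.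
   Context: For a binary operation $*$ on $X$, the boundary $\partial_n^{( * )}:\mathbb Z X^{n+1}\to\mathbb Z X^{n}$ ($n\ge1$) is the linear map $$\partial_n^{( * )}(x_0,\dots,x_n)=(x_1,\dots,x_n)+\sum_{i=1}^n(-1)^i(x_0*x_i,\dots,x_{i-1}*x_i,x_{i+1},\dots,x_n).$$ Without augmentation, $C_{-1}=0$. The augmented complex has $C_{-1}=\mathbb Z$ and $\partial_0(x)=1$ for $x\in X$, and its homology is denoted $\tilde H$. $\mathbb Z_d=\mathbb Z/d\mathbb Z$. *)

theory Defs
  imports "HOL-Algebra.Free_Abelian_Groups"
begin

definition chain_group :: "'a set \<Rightarrow> nat \<Rightarrow> ('a list \<Rightarrow>\<^sub>0 int) monoid" where
  "chain_group X n = free_Abelian_group {xs. length xs = Suc n \<and> set xs \<subseteq> X}"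

text \<open>For \<open>xs = [x\<^sub>0, \<dots>, x\<^sub>n]\<close> this is
  \<open>[x\<^sub>0 * x\<^sub>i, \<dots>, x\<^bsub>i-1\<^esub> * x\<^sub>i, x\<^bsub>i+1\<^esub>, \<dots>, x\<^sub>n]\<close>.\<close>

definition face :: "('a \<Rightarrow> 'a \<Rightarrow> 'a) \<Rightarrow> nat \<Rightarrow> 'a list \<Rightarrow> 'a list" where
  "face star i xs = map (\<lambda>a. star a (xs ! i)) (take i xs) @ drop (Suc i) xs"

text \<open>Meant for \<open>n \<ge> 1\<close>; the map out of degree 0 is fixed separately in the two
  homology groups below.\<close>

definition boundary :: "('a \<Rightarrow> 'a \<Rightarrow> 'a) \<Rightarrow> nat \<Rightarrow> ('a list \<Rightarrow>\<^sub>0 int) \<Rightarrow> ('a list \<Rightarrow>\<^sub>0 int)" where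
  "boundary star n =
     frag_extend (\<lambda>xs. frag_of (tl xs) + (\<Sum>i=1..n. frag_cmul ((-1) ^ i) (frag_of (face star i xs))))"

definition scaled_boundary ::
    "int \<Rightarrow> ('a \<Rightarrow> 'a \<Rightarrow> 'a) \<Rightarrow> nat \<Rightarrow> ('a list \<Rightarrow>\<^sub>0 int) \<Rightarrow> ('a list \<Rightarrow>\<^sub>0 int)" where
  "scaled_boundary d star n c = frag_cmul d (boundary star n c)"

text \<open>The linear map sending every basis element to 1.\<close>

definition augmentation :: "('a list \<Rightarrow>\<^sub>0 int) \<Rightarrow> int" where
  "augmentation c = (\<Sum>xs\<in>Poly_Mapping.keys c. Poly_Mapping.lookup c xs)"

text \<open>Homology at the middle term of \<open>G \<rightarrow> H \<rightarrow> K\<close>, with maps \<open>f\<close> and \<open>h\<close>.\<close>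

definition homology_at ::
    "'a monoid \<Rightarrow> ('a \<Rightarrow> 'b) \<Rightarrow> 'b monoid \<Rightarrow> ('b \<Rightarrow> 'c) \<Rightarrow> 'c monoid \<Rightarrow> 'b set monoid" where
  "homology_at G f H h K = (H\<lparr>carrier := kernel H K h\<rparr>) Mod (f ` carrier G)"

fun homology ::
    "int \<Rightarrow> ('a \<Rightarrow> 'a \<Rightarrow> 'a) \<Rightarrow> 'a set \<Rightarrow> nat \<Rightarrow> ('a list \<Rightarrow>\<^sub>0 int) set monoid" where
  "homology d star X 0 =
     homology_at (chain_group X 1) (scaled_boundary d star 1) (chain_group X 0)
       (\<lambda>_. ()) (singleton_group ())"
| "homology d star X (Suc n) =
     homology_at (chain_group X (Suc (Suc n))) (scaled_boundary d star (Suc (Suc n)))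
       (chain_group X (Suc n)) (scaled_boundary d star (Suc n)) (chain_group X n)"

text \<open>The augmentation is not multiplied by \<open>d\<close>.\<close>

fun augmented_homology ::
    "int \<Rightarrow> ('a \<Rightarrow> 'a \<Rightarrow> 'a) \<Rightarrow> 'a set \<Rightarrow> nat \<Rightarrow> ('a list \<Rightarrow>\<^sub>0 int) set monoid" where
  "augmented_homology d star X 0 =
     homology_at (chain_group X 1) (scaled_boundary d star 1) (chain_group X 0)
       augmentation integer_group"
| "augmented_homology d star X (Suc n) =
     homology_at (chain_group X (Suc (Suc n))) (scaled_boundary d star (Suc (Suc n)))
       (chain_group X (Suc n)) (scaled_boundary d star (Suc n)) (chain_group X n)"

definition int_mod :: "int \<Rightarrow> int set monoid" where
  "int_mod d = integer_group Mod range ((*) d)"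

definition group_power :: "'a monoid \<Rightarrow> nat \<Rightarrow> (nat \<Rightarrow> 'a) monoid" where
  "group_power G k = sum_group {..<k} (\<lambda>_. G)"

text \<open>The number \<open>u\<^sub>n = |X|\<^sup>n - |X|\<^bsup>n-1\<^esup> + \<dots> + (-1)\<^sup>n\<close>.\<close>

definition alt_card_sum :: "'a set \<Rightarrow> nat \<Rightarrow> int" where
  "alt_card_sum X n = (\<Sum>k=0..n. (-1) ^ k * int (card X) ^ (n - k))"

text \<open>The exponents of the torsion summands are integers that are converted by \<^const>\<open>nat\<close>.
  The next two lemmas show that nothing is truncated.\<close>

lemma alt_card_sum_Suc: "alt_card_sum X (Suc n) = int (card X) ^ Suc n - alt_card_sum X n"
  by (simp add: alt_card_sum_def sum.atLeast0_atMost_Suc_shift sum_negf del: sum.cl_ivl_Suc)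

lemma alt_card_sum_bounds:
  assumes "finite X" "X \<noteq> {}"
  shows "0 \<le> alt_card_sum X n \<and> alt_card_sum X n \<le> int (card X) ^ n"
proof (induction n)
  case 0
  show ?case by (simp add: alt_card_sum_def)
next
  case (Suc n)
  have "1 \<le> int (card X)"
    using assms by (simp add: Suc_leI card_gt_0_iff)
  then have "int (card X) ^ n \<le> int (card X) ^ Suc n"
    by (intro power_increasing) auto
  with Suc show ?case
    unfolding alt_card_sum_Suc by linarith
qed

lemma torsion_exponent_nonneg:
  assumes "finite X" "X \<noteq> {}" "g \<in> X \<rightarrow> X"
  shows "0 \<le> int (card X) ^ (n + 1) - int (card (g ` X)) * alt_card_sum X n"
proof -
  have "int (card (g ` X)) * alt_card_sum X n \<le> int (card X) * int (card X) ^ n"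
    using alt_card_sum_bounds[OF assms(1,2)] by (intro mult_mono) (auto simp: assms(1) card_image_le)
  then show ?thesis by simp
qed

lemma torsion_exponent_id_nonneg:
  assumes "finite X" "X \<noteq> {}"
  shows "0 \<le> alt_card_sum X n - (-1) ^ n"
proof (cases n)
  case 0
  then show ?thesis by (simp add: alt_card_sum_def)
next
  case (Suc m)
  have "alt_card_sum X n - (-1) ^ n = int (card X) * (\<Sum>k=0..m. (-1) ^ k * int (card X) ^ (m - k))"
    unfolding alt_card_sum_def Suc by (simp add: sum_distrib_left Suc_diff_le mult_ac)
  also have "\<dots> = int (card X) * alt_card_sum X m"
    by (simp add: alt_card_sum_def)
  finally show ?thesis using alt_card_sum_bounds[OF assms] by simp
qed

end

(* Since x * y = g y, the boundary of (x_0, ..., x_n) does not depend on x_0; as a function of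
   (x_1, ..., x_n) it is an idempotent linear map P of Z X^n. With the cone
   s(x_1, ..., x_n) = (g x_1, x_1, ..., x_n) it satisfies the recursion
     P(a, xs) = (a, xs) - (g a, xs) + s(xs - P xs).
   By induction this gives a basis of Z X^{n+1} consisting of
     (a, xs) - (g a, xs) for a not in g X, fixed by P and killed by the boundary,
     (a, xs) - s xs for a in g X different from the first entry of s xs, killed by P and by
       the boundary,
     s b for b in the basis of Z X^n, where s b is fixed by P if P b = 0 and killed by P if
       P b = b, while its boundary is P b.
   Both the cycles and the image of P are spanned by subsets of this basis, so the homology of
   d times the boundary is read off by counting: basis elements in the image give Z_d, the other
   basis cycles give Z. Using the one-element set X^0, with the cone of the empty tuple being a
   fixed point of g, the augmentation becomes the boundary in degree 0. *)
theory Submission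
  imports Defs
begin

section \<open>Linear extension and supports in free abelian groups\<close>

lemma frag_extend_frag_extend:
  "frag_extend f (frag_extend h c) = frag_extend (\<lambda>x. frag_extend f (h x)) c"
  by (rule frag_induction[of c UNIV]) (auto simp: frag_extend_diff)

lemma frag_extend_eq_id:
  assumes "Poly_Mapping.keys c \<subseteq> S" "\<And>x. x \<in> S \<Longrightarrow> f x = frag_of x"
  shows "frag_extend f c = c"
  by (metis (no_types, lifting) assms frag_expansion frag_extend_eq subsetD)

lemma keys_frag_extend_subset:
  assumes "Poly_Mapping.keys c \<subseteq> S" "\<And>x. x \<in> S \<Longrightarrow> Poly_Mapping.keys (f x) \<subseteq> T"
  shows "Poly_Mapping.keys (frag_extend f c) \<subseteq> T"
  using keys_frag_extend[of f c] assms by blast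

lemma keys_diff_subset:
  "Poly_Mapping.keys a \<subseteq> T \<Longrightarrow> Poly_Mapping.keys b \<subseteq> T \<Longrightarrow>
    Poly_Mapping.keys (a - b :: 'a \<Rightarrow>\<^sub>0 int) \<subseteq> T"
  using keys_diff[of a b] by blast

lemma keys_add_subset:
  "Poly_Mapping.keys a \<subseteq> T \<Longrightarrow> Poly_Mapping.keys b \<subseteq> T \<Longrightarrow>
    Poly_Mapping.keys (a + b :: 'a \<Rightarrow>\<^sub>0 int) \<subseteq> T"
  using keys_add[of a b] by blast

section \<open>Tuples as bases of the chain groups\<close>

definition tuples :: "'a set \<Rightarrow> nat \<Rightarrow> 'a list set" where
  "tuples X n = {xs. length xs = n \<and> set xs \<subseteq> X}"

lemma tuples_0: "tuples X 0 = {[]}"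
  by (auto simp: tuples_def)

lemma tuples_Suc: "tuples X (Suc n) = (\<lambda>(a, xs). a # xs) ` (X \<times> tuples X n)"
  by (auto simp: tuples_def length_Suc_conv image_iff)

lemma Cons_in_tuples [simp]: "a # xs \<in> tuples X (Suc n) \<longleftrightarrow> a \<in> X \<and> xs \<in> tuples X n"
  by (auto simp: tuples_def)

lemma finite_tuples: "finite X \<Longrightarrow> finite (tuples X n)"
  using finite_lists_length_eq[of X n] by (simp add: tuples_def conj_commute)

lemma card_tuples: "finite X \<Longrightarrow> card (tuples X n) = card X ^ n"
  using card_lists_length_eq[of X n] by (simp add: tuples_def conj_commute)

lemma tuples_subset_lists: "tuples X n \<subseteq> lists X"
  by (auto simp: tuples_def)

lemma keys_lists:
  "Poly_Mapping.keys c \<subseteq> tuples X n \<Longrightarrow> Poly_Mapping.keys c \<subseteq> lists X"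
  using tuples_subset_lists by blast

lemma chain_group_eq: "chain_group X n = free_Abelian_group (tuples X (Suc n))"
  by (simp add: chain_group_def tuples_def)

section \<open>Quotients of free abelian groups by multiples of basis elements\<close>

lemma poly_mapping_prescribed:
  fixes f :: "'a \<Rightarrow> int"
  assumes "finite Q"
  obtains e where "Poly_Mapping.keys e \<subseteq> Q" "\<And>q. q \<in> Q \<Longrightarrow> Poly_Mapping.lookup e q = f q"
proof
  define e where "e = (\<Sum>q\<in>Q. Poly_Mapping.single q (f q))"
  have lookup: "Poly_Mapping.lookup e q = (if q \<in> Q then f q else 0)" for q
    using assms by (simp add: e_def lookup_sum lookup_single when_def)
  show "Poly_Mapping.keys e \<subseteq> Q"
    by (auto simp: in_keys_iff lookup split: if_splits)
  show "Poly_Mapping.lookup e q = f q" if "q \<in> Q" for q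
    using that by (simp add: lookup)
qed

lemma normal_multiples: "range ((*) d) \<lhd> integer_group"
proof -
  have "subgroup (range ((*) d)) integer_group"
    by (rule group.subgroupI)
       (auto simp flip: distrib_left mult_minus_right intro!: rangeI)
  then show ?thesis
    by (simp add: comm_group.normal_iff_subgroup[OF abelian_integer_group])
qed

lemma group_int_mod [simp]: "group (int_mod d)"
  unfolding int_mod_def by (rule normal.factorgroup_is_group[OF normal_multiples])

lemma carrier_group_power:
  "group G \<Longrightarrow> carrier (group_power G k) = {..<k} \<rightarrow>\<^sub>E carrier G"
  by (auto simp: group_power_def carrier_sum_group)

lemma group_group_power [simp]: "group G \<Longrightarrow> group (group_power G k)"
  by (simp add: group_power_def)

lemma ball_bij_betw: "bij_betw f A B \<Longrightarrow> (\<forall>b\<in>B. P b) \<longleftrightarrow> (\<forall>a\<in>A. P (f a))"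
  by (auto simp: bij_betw_def)

lemma restrict_eq_iff: "restrict f A = restrict h A \<longleftrightarrow> (\<forall>x\<in>A. f x = h x)"
  by (auto simp: restrict_def fun_eq_iff)

text \<open>Keep the coordinates outside \<open>E\<close> and reduce those in \<open>E\<close> mod
  \<open>d\<close>: the kernel of this surjection is the subgroup divided out, so the first
  isomorphism theorem applies. Leaving \<open>H\<close> abstract allows \<open>H\<close> to be a
  group of cycles, whose basis does not consist of tuples.\<close>

lemma free_Abelian_group_quotient_iso:
  assumes "group H" and \<theta>: "\<theta> \<in> iso H (free_Abelian_group Q)" and "finite Q" and EQ: "E \<subseteq> Q"
  shows "H Mod {c \<in> carrier H. \<exists>e. Poly_Mapping.keys e \<subseteq> E \<and> \<theta> c = frag_cmul d e} \<cong>
    group_power integer_group (card (Q - E)) \<times>\<times> group_power (int_mod d) (card E)"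
proof -
  let ?l = "Poly_Mapping.lookup"
  let ?T = "group_power integer_group (card (Q - E)) \<times>\<times> group_power (int_mod d) (card E)"
  have finE: "finite E"
    using assms finite_subset by blast
  obtain \<alpha> where \<alpha>: "bij_betw \<alpha> {..<card E} E"
    using ex_bij_betw_nat_finite[OF finE] by (auto simp: atLeast0LessThan)
  obtain \<beta> where \<beta>: "bij_betw \<beta> {..<card (Q - E)} (Q - E)"
    using ex_bij_betw_nat_finite[of "Q - E"] \<open>finite Q\<close> by (auto simp: atLeast0LessThan)
  define \<pi> where "\<pi> = r_coset integer_group (range ((*) d))"
  have \<pi>_hom: "\<pi> \<in> hom integer_group (int_mod d)"
    unfolding \<pi>_def int_mod_def by (rule normal.r_coset_hom_Mod[OF normal_multiples])
  have \<pi>_surj: "carrier (int_mod d) = range \<pi>"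
    by (auto simp: int_mod_def carrier_FactGroup \<pi>_def)
  have sub: "subgroup (range ((*) d)) integer_group"
    using normal_multiples by (rule normal_imp_subgroup)
  have \<pi>_one: "\<pi> x = \<one>\<^bsub>int_mod d\<^esub> \<longleftrightarrow> d dvd x" for x
    using group.coset_join1[of integer_group "range ((*) d)" x]
      group.coset_join2[of integer_group x "range ((*) d)"] sub
    by (auto simp: \<pi>_def int_mod_def dvd_def)
  define h where "h = (\<lambda>c. (\<lambda>i\<in>{..<card (Q - E)}. ?l (\<theta> c) (\<beta> i), \<lambda>i\<in>{..<card E}. \<pi> (?l (\<theta> c) (\<alpha> i))))"
  have carrier_T: "carrier ?T = ({..<card (Q - E)} \<rightarrow>\<^sub>E UNIV) \<times> ({..<card E} \<rightarrow>\<^sub>E range \<pi>)"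
    by (simp add: carrier_group_power \<pi>_surj)
  have h_hom: "h \<in> hom H ?T"
  proof (rule homI)
    show "h c \<in> carrier ?T" for c
      unfolding carrier_T by (auto simp: h_def)
    fix a b assume "a \<in> carrier H" "b \<in> carrier H"
    then have "\<theta> (a \<otimes>\<^bsub>H\<^esub> b) = \<theta> a + \<theta> b"
      using \<theta> by (simp add: iso_def hom_def)
    then show "h (a \<otimes>\<^bsub>H\<^esub> b) = h a \<otimes>\<^bsub>?T\<^esub> h b"
      using \<pi>_hom by (auto simp: h_def group_power_def lookup_add hom_def intro!: restrict_ext)
  qed
  have grp_T: "group ?T"
    by (simp add: DirProd_group)
  interpret h: group_hom H ?T h
    using h_hom grp_T \<open>group H\<close> by (simp add: group_hom_def group_hom_axioms_def)
  have keys_\<theta>: "Poly_Mapping.keys (\<theta> c) \<subseteq> Q" if "c \<in> carrier H" for c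
    using \<theta> that by (metis (no_types) Group.iso_iff carrier_free_Abelian_group_iff imageI)
  have h_one: "h c = \<one>\<^bsub>?T\<^esub> \<longleftrightarrow> (\<forall>q\<in>Q - E. ?l (\<theta> c) q = 0) \<and> (\<forall>q\<in>E. d dvd ?l (\<theta> c) q)" for c
  proof -
    have "h c = \<one>\<^bsub>?T\<^esub> \<longleftrightarrow> (\<forall>i\<in>{..<card (Q - E)}. ?l (\<theta> c) (\<beta> i) = 0) \<and>
        (\<forall>i\<in>{..<card E}. d dvd ?l (\<theta> c) (\<alpha> i))"
      by (simp add: h_def group_power_def restrict_eq_iff \<pi>_one)
    then show ?thesis
      using ball_bij_betw[OF \<alpha>, of "\<lambda>q. d dvd ?l (\<theta> c) q"]
        ball_bij_betw[OF \<beta>, of "\<lambda>q. ?l (\<theta> c) q = 0"] by simp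
  qed
  have "kernel H ?T h = {c \<in> carrier H. \<exists>e. Poly_Mapping.keys e \<subseteq> E \<and> \<theta> c = frag_cmul d e}"
  proof -
    have "h c = \<one>\<^bsub>?T\<^esub> \<longleftrightarrow> (\<exists>e. Poly_Mapping.keys e \<subseteq> E \<and> \<theta> c = frag_cmul d e)"
      if c: "c \<in> carrier H" for c
    proof
      assume one: "h c = \<one>\<^bsub>?T\<^esub>"
      \<comment> \<open>The division is exact because \<open>d\<close> divides these coefficients;
        for \<open>d = 0\<close> they are 0, and \<open>div\<close> by 0 gives 0 too.\<close>
      obtain e where e: "Poly_Mapping.keys e \<subseteq> E" "\<And>q. q \<in> E \<Longrightarrow> ?l e q = ?l (\<theta> c) q div d"
        using poly_mapping_prescribed[OF finE, of "\<lambda>q. ?l (\<theta> c) q div d"] by auto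
      have "?l (\<theta> c) q = d * ?l e q" for q
      proof (cases "q \<in> E")
        case True
        with e one h_one show ?thesis by auto
      next
        case False
        then have "?l (\<theta> c) q = 0"
          using keys_\<theta>[OF c] one h_one by (metis DiffI in_keys_iff subsetD)
        moreover have "?l e q = 0"
          using False e(1) by (auto simp: in_keys_iff)
        ultimately show ?thesis by simp
      qed
      then have "\<theta> c = frag_cmul d e"
        by (intro poly_mapping_eqI) simp
      with e show "\<exists>e. Poly_Mapping.keys e \<subseteq> E \<and> \<theta> c = frag_cmul d e" by blast
    next
      assume "\<exists>e. Poly_Mapping.keys e \<subseteq> E \<and> \<theta> c = frag_cmul d e"
      then show "h c = \<one>\<^bsub>?T\<^esub>"
        unfolding h_one by (auto simp: in_keys_iff)
    qed
    then show ?thesis by (auto simp: kernel_def)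
  qed
  moreover have "h ` carrier H = carrier ?T"
  proof
    show "h ` carrier H \<subseteq> carrier ?T"
      using h.hom_closed by blast
    show "carrier ?T \<subseteq> h ` carrier H"
    proof
      fix p assume "p \<in> carrier ?T"
      then obtain u v where p: "p = (u, v)" "u \<in> {..<card (Q - E)} \<rightarrow>\<^sub>E UNIV"
          "v \<in> {..<card E} \<rightarrow>\<^sub>E range \<pi>"
        unfolding carrier_T by auto
      \<comment> \<open>A preimage of \<open>(u, v)\<close>: undo both enumerations and let
        \<open>inv_into\<close> choose an integer in each residue class.\<close>
      obtain e where e: "Poly_Mapping.keys e \<subseteq> Q" "\<And>q. q \<in> Q \<Longrightarrow>
          ?l e q = (if q \<in> E then inv_into UNIV \<pi> (v (inv_into {..<card E} \<alpha> q))
            else u (inv_into {..<card (Q - E)} \<beta> q))"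
        using poly_mapping_prescribed[OF \<open>finite Q\<close>, of "\<lambda>q. if q \<in> E
          then inv_into UNIV \<pi> (v (inv_into {..<card E} \<alpha> q))
          else u (inv_into {..<card (Q - E)} \<beta> q)"] by auto
      then obtain c where c: "c \<in> carrier H" "\<theta> c = e"
        using \<theta> by (metis (no_types, lifting) Group.iso_iff carrier_free_Abelian_group_iff imageE)
      have "?l e (\<beta> i) = u i" if "i < card (Q - E)" for i
        using that \<beta> e(2)[of "\<beta> i"] bij_betw_apply[OF \<beta>, of i]
        by (simp add: bij_betw_inv_into_left)
      moreover have "\<pi> (?l e (\<alpha> i)) = v i" if "i < card E" for i
      proof -
        have "v i \<in> range \<pi>"
          using p(3) that by auto
        then show ?thesis
          using that \<alpha> EQ e(2)[of "\<alpha> i"] bij_betw_apply[OF \<alpha>, of i]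
          by (auto simp: bij_betw_inv_into_left f_inv_into_f)
      qed
      ultimately have "h c = p"
        using p by (auto simp: h_def c PiE_iff extensional_def restrict_def fun_eq_iff)
      with c show "p \<in> h ` carrier H" by blast
    qed
  qed
  ultimately show ?thesis
    using h.FactGroup_iso by simp
qed

text \<open>Cosets of the trivial subgroup are singletons. This serves \<open>d = 0\<close>, where
  only 0 is a boundary.\<close>

lemma (in group) r_coset_one_iso: "r_coset G {\<one>} \<in> iso G (G Mod {\<one>})"
proof -
  have eq: "r_coset G {\<one>} x = {x}" if "x \<in> carrier G" for x
    using that by (simp add: r_coset_def)
  have "r_coset G {\<one>} \<in> hom G (G Mod {\<one>})"
    by (rule normal.r_coset_hom_Mod) (rule one_is_normal)
  moreover have "bij_betw (r_coset G {\<one>}) (carrier G) (carrier (G Mod {\<one>}))"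
    unfolding carrier_FactGroup by (auto simp: bij_betw_def inj_on_def eq)
  ultimately show ?thesis by (simp add: iso_def)
qed

lemma free_Abelian_group_iso_group_power:
  assumes "finite S"
  shows "free_Abelian_group S \<cong> group_power integer_group (card S)"
proof -
  have "S \<approx> {..<card S}"
    using assms by (simp add: eqpoll_iff_card)
  then have "free_Abelian_group S \<cong> free_Abelian_group {..<card S}"
    by (simp add: isomorphic_free_Abelian_groups)
  also have "free_Abelian_group {..<card S} \<cong> group_power integer_group (card S)"
    unfolding group_power_def
    by (rule group.iso_sym) (simp_all add: isomorphic_sum_integer_group)
  finally show ?thesis .
qed

section \<open>The cone, the projection and the adapted basis\<close>

locale idempotent_map =
  fixes X :: "'a set" and g :: "'a \<Rightarrow> 'a" and y0 :: 'a
  assumes g_in: "a \<in> X \<Longrightarrow> g a \<in> X" and g_idem: "a \<in> X \<Longrightarrow> g (g a) = g a"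
    and y0_in: "y0 \<in> X" and g_y0: "g y0 = y0"
begin

definition base :: "'a list \<Rightarrow> 'a" where
  "base xs = (case xs of [] \<Rightarrow> y0 | x # _ \<Rightarrow> g x)"

definition cone :: "('a list \<Rightarrow>\<^sub>0 int) \<Rightarrow> ('a list \<Rightarrow>\<^sub>0 int)" where
  "cone = frag_extend (\<lambda>xs. frag_of (base xs # xs))"

primrec proj :: "'a list \<Rightarrow> ('a list \<Rightarrow>\<^sub>0 int)" where
  "proj [] = frag_of []"
| "proj (a # xs) = frag_of (a # xs) - frag_of (g a # xs) + cone (frag_of xs - proj xs)"

text \<open>\<open>adapted xs\<close> is the basis element with index \<open>xs\<close>, and \<open>coords\<close> expresses a tuple in this
  basis. For \<open>a \<in> X\<close>, the condition \<open>g a = a\<close> says that \<open>a\<close> lies in \<open>g ` X\<close>.\<close>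

primrec adapted :: "'a list \<Rightarrow> ('a list \<Rightarrow>\<^sub>0 int)" where
  "adapted [] = frag_of []"
| "adapted (a # xs) =
    (if g a \<noteq> a then frag_of (a # xs) - frag_of (g a # xs)
     else if a \<noteq> base xs then frag_of (a # xs) - frag_of (base xs # xs)
     else cone (adapted xs))"

primrec coords :: "'a list \<Rightarrow> ('a list \<Rightarrow>\<^sub>0 int)" where
  "coords [] = frag_of []"
| "coords (a # xs) =
    (if g a \<noteq> a then frag_of (a # xs) else 0) +
    (if g a \<noteq> base xs then frag_of (g a # xs) else 0) + cone (coords xs)"

text \<open>Selects the indices whose basis element is fixed by \<open>proj\<close>; the negation
  reflects that the cone exchanges fixed and killed elements.\<close>

primrec in_image :: "'a list \<Rightarrow> bool" where
  "in_image [] \<longleftrightarrow> True"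
| "in_image (a # xs) \<longleftrightarrow> g a \<noteq> a \<or> a = base xs \<and> \<not> in_image xs"

text \<open>Intended for nonempty lists: the basis elements with nonzero boundary are the cones over
  basis elements fixed by \<open>proj\<close>.\<close>

definition in_kernel :: "'a list \<Rightarrow> bool" where
  "in_kernel xs \<longleftrightarrow> hd xs \<noteq> base (tl xs) \<or> \<not> in_image (tl xs)"

lemma base_Nil [simp]: "base [] = y0"
  and base_Cons [simp]: "base (x # xs) = g x"
  by (simp_all add: base_def)

lemma base_in: "xs \<in> lists X \<Longrightarrow> base xs \<in> X"
  by (cases xs) (auto simp: y0_in g_in)

lemma g_base: "xs \<in> lists X \<Longrightarrow> g (base xs) = base xs"
  by (cases xs) (auto simp: g_y0 g_idem)

lemma cone_of [simp]: "cone (frag_of xs) = frag_of (base xs # xs)"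
  and cone_0 [simp]: "cone 0 = 0"
  and cone_diff: "cone (a - b) = cone a - cone b"
  and cone_cmul: "cone (frag_cmul k a) = frag_cmul k (cone a)"
  by (simp_all add: cone_def frag_extend_diff frag_extend_cmul)

lemma tuples_listsD: "xs \<in> tuples X n \<Longrightarrow> xs \<in> lists X"
  using tuples_subset_lists by blast

lemma base_in_tuples: "xs \<in> tuples X n \<Longrightarrow> base xs \<in> X"
  and g_base_tuples: "xs \<in> tuples X n \<Longrightarrow> g (base xs) = base xs"
  by (simp_all add: base_in g_base tuples_listsD)

lemma keys_cone:
  "Poly_Mapping.keys c \<subseteq> tuples X n \<Longrightarrow> Poly_Mapping.keys (cone c) \<subseteq> tuples X (Suc n)"
  unfolding cone_def
  by (rule keys_frag_extend_subset) (auto simp: base_in_tuples)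

lemma keys_proj: "xs \<in> tuples X n \<Longrightarrow> Poly_Mapping.keys (proj xs) \<subseteq> tuples X n"
proof (induction xs arbitrary: n)
  case (Cons a xs)
  then obtain m where n: "n = Suc m"
    by (auto simp: tuples_def)
  with Cons have "Poly_Mapping.keys (cone (frag_of xs - proj xs)) \<subseteq> tuples X (Suc m)"
    by (intro keys_cone keys_diff_subset) auto
  with Cons.prems show ?case
    unfolding proj.simps n by (intro keys_add_subset keys_diff_subset) (simp_all add: g_in)
qed auto

lemma keys_adapted: "xs \<in> tuples X n \<Longrightarrow> Poly_Mapping.keys (adapted xs) \<subseteq> tuples X n"
proof (induction xs arbitrary: n)
  case (Cons a xs)
  then obtain m where n: "n = Suc m"
    by (auto simp: tuples_def)
  with Cons have "Poly_Mapping.keys (cone (adapted xs)) \<subseteq> tuples X (Suc m)"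
    by (intro keys_cone) auto
  moreover have "base xs \<in> X"
    using Cons.prems n by (simp add: base_in_tuples[of xs m])
  ultimately show ?case
    using Cons.prems unfolding adapted.simps n by (simp add: keys_diff_subset g_in)
qed auto

lemma keys_coords: "xs \<in> tuples X n \<Longrightarrow> Poly_Mapping.keys (coords xs) \<subseteq> tuples X n"
proof (induction xs arbitrary: n)
  case (Cons a xs)
  then obtain m where n: "n = Suc m"
    by (auto simp: tuples_def)
  with Cons have "Poly_Mapping.keys (cone (coords xs)) \<subseteq> tuples X (Suc m)"
    by (intro keys_cone) auto
  with Cons n show ?case
    unfolding coords.simps n by (intro keys_add_subset) (simp_all add: g_in)
qed auto

section \<open>Change of basis and diagonalization of the projection\<close>

lemma adapted_cone:
  assumes "Poly_Mapping.keys c \<subseteq> lists X"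
  shows "frag_extend adapted (cone c) = cone (frag_extend adapted c)"
  unfolding cone_def frag_extend_frag_extend
  \<comment> \<open>\<open>g\<close> fixes \<open>base xs\<close>, so \<open>base xs # xs\<close>
    falls into the last case of \<open>adapted\<close>.\<close>
  by (rule frag_extend_eq) (simp add: g_base cone_def subsetD[OF assms])

lemma coords_cone:
  assumes "Poly_Mapping.keys c \<subseteq> lists X"
  shows "frag_extend coords (cone c) = cone (frag_extend coords c)"
  unfolding cone_def frag_extend_frag_extend
  by (rule frag_extend_eq) (simp add: g_base cone_def subsetD[OF assms])

text \<open>On \<open>base xs # xs\<close> the first two terms in the recursion of
  \<open>proj\<close> cancel, because \<open>g\<close> fixes \<open>base xs\<close>.\<close>

lemma proj_cone:
  assumes "Poly_Mapping.keys c \<subseteq> lists X"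
  shows "frag_extend proj (cone c) = cone (c - frag_extend proj c)"
  using assms
proof (induction c rule: frag_induction)
  case (diff a b)
  then show ?case
    by (simp add: cone_diff frag_extend_diff)
qed (auto simp: g_base)

lemma keys_adapted_lists: "xs \<in> lists X \<Longrightarrow> Poly_Mapping.keys (adapted xs) \<subseteq> lists X"
  using keys_adapted[of xs "length xs"] by (auto simp: tuples_def in_lists_conv_set)

lemma keys_coords_lists: "xs \<in> lists X \<Longrightarrow> Poly_Mapping.keys (coords xs) \<subseteq> lists X"
  using keys_coords[of xs "length xs"] by (auto simp: tuples_def in_lists_conv_set)

text \<open>Telescoping: with \<open>b = base xs\<close>, the tuple \<open>(a, xs)\<close> is
  \<open>(a, xs) - (g a, xs)\<close> plus \<open>(g a, xs) - (b, xs)\<close> plus the cone over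
  \<open>xs\<close>, whose tail is expanded recursively. Differences that vanish are the ones that
  \<open>coords\<close> omits.\<close>

lemma adapted_coords_of: "xs \<in> lists X \<Longrightarrow> frag_extend adapted (coords xs) = frag_of xs"
proof (induction xs)
  case (Cons a xs)
  then have "frag_extend adapted (cone (coords xs)) = frag_of (base xs # xs)"
    by (simp add: adapted_cone keys_coords_lists)
  with Cons show ?case
    by (auto simp: frag_extend_add g_base g_idem)
qed auto

text \<open>For a difference of lists with equal tails the cone terms of \<open>coords\<close>
  cancel, and idempotence of \<open>g\<close> leaves the single index \<open>a # xs\<close>.\<close>

lemma coords_adapted_of: "xs \<in> lists X \<Longrightarrow> frag_extend coords (adapted xs) = frag_of xs"
proof (induction xs)
  case (Cons a xs)
  then have "frag_extend coords (cone (adapted xs)) = frag_of (base xs # xs)"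
    by (simp add: coords_cone keys_adapted_lists)
  with Cons show ?case
    by (auto simp: frag_extend_diff g_base g_idem)
qed auto

lemma adapted_coords: "Poly_Mapping.keys c \<subseteq> lists X \<Longrightarrow> frag_extend adapted (frag_extend coords c) = c"
  by (simp add: frag_extend_frag_extend frag_extend_eq_id adapted_coords_of)

lemma coords_adapted: "Poly_Mapping.keys c \<subseteq> lists X \<Longrightarrow> frag_extend coords (frag_extend adapted c) = c"
  by (simp add: frag_extend_frag_extend frag_extend_eq_id coords_adapted_of)

text \<open>The cone term of \<open>proj\<close> depends only on the tail, so it cancels in a
  difference; what remains is the difference itself if \<open>g\<close> moves \<open>a\<close>, and
  0 if \<open>g\<close> fixes both heads. Cones are handled by \<open>proj_cone\<close>.\<close>

lemma proj_adapted_of: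
  "xs \<in> lists X \<Longrightarrow> frag_extend proj (adapted xs) = (if in_image xs then adapted xs else 0)"
proof (induction xs)
  case (Cons a xs)
  then have "frag_extend proj (cone (adapted xs)) = (if in_image xs then 0 else cone (adapted xs))"
    by (simp add: proj_cone keys_adapted_lists)
  with Cons show ?case
    by (auto simp: frag_extend_diff g_base g_idem)
qed auto

section \<open>The boundary map through the projection\<close>

definition bd :: "('a list \<Rightarrow>\<^sub>0 int) \<Rightarrow> ('a list \<Rightarrow>\<^sub>0 int)" where
  "bd = frag_extend (\<lambda>xs. proj (tl xs))"

lemma bd_cone: "bd (cone c) = frag_extend proj c"
  by (simp add: bd_def cone_def frag_extend_frag_extend)

text \<open>Differences of tuples with equal tails have no boundary; for cones
  \<open>bd_cone\<close> reduces the claim to \<open>proj_adapted_of\<close>.\<close>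

lemma bd_adapted_of:
  assumes "xs \<in> lists X" "xs \<noteq> []"
  shows "bd (adapted xs) = (if in_kernel xs then 0 else adapted (tl xs))"
proof -
  obtain a ys where xs: "xs = a # ys" using assms(2) by (cases xs) auto
  have "bd (cone (adapted ys)) = (if in_image ys then adapted ys else 0)"
    using assms xs by (simp add: bd_cone proj_adapted_of)
  moreover have "bd (frag_of (u # ys) - frag_of (v # ys)) = 0" for u v
    by (simp add: bd_def frag_extend_diff)
  ultimately show ?thesis
    using assms xs by (auto simp: in_kernel_def g_base)
qed

text \<open>Here \<open>xs\<close> is the tail of the tuple whose boundary is taken. For
  \<open>a # xs\<close>, term 1 is minus \<open>(g a, xs)\<close>, and term \<open>i + 1\<close> is
  minus the cone of term \<open>i\<close> for \<open>xs\<close>: that face begins with a value of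
  \<open>g\<close>, which the cone repeats.\<close>

lemma proj_eq_alternating_sum:
  assumes "xs \<in> lists X"
  shows "frag_of xs + (\<Sum>i=1..length xs. frag_cmul ((-1) ^ i)
           (frag_of (replicate i (g (xs ! (i - 1))) @ drop i xs))) = proj xs"
  using assms
proof (induction xs)
  case (Cons a xs)
  define F where "F = (\<lambda>i. frag_of (replicate i (g (xs ! (i - 1))) @ drop i xs))"
  have F: "frag_of (replicate (Suc i) (g (xs ! (i - 1))) @ drop i xs) = cone (F i)"
    if "i \<in> {1..length xs}" for i
  proof -
    from that obtain j where i: "i = Suc j" "j < length xs" by (cases i) auto
    have "\<forall>x\<in>set xs. x \<in> X"
      using Cons.hyps by auto
    with i have "xs ! j \<in> X"
      by simp
    with i show ?thesis by (simp add: F_def g_idem)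
  qed
  have "(\<Sum>i=1..length (a # xs). frag_cmul ((-1) ^ i)
           (frag_of (replicate i (g ((a # xs) ! (i - 1))) @ drop i (a # xs))))
      = - frag_of (g a # xs) + (\<Sum>i=1..length xs. frag_cmul ((-1) ^ Suc i)
           (frag_of (replicate (Suc i) (g ((a # xs) ! i)) @ drop i xs)))"
    by (simp add: sum.atLeast_Suc_atMost sum.shift_bounds_cl_Suc_ivl del: sum.cl_ivl_Suc)
  also have "(\<Sum>i=1..length xs. frag_cmul ((-1) ^ Suc i)
           (frag_of (replicate (Suc i) (g ((a # xs) ! i)) @ drop i xs)))
      = (\<Sum>i=1..length xs. - cone (frag_cmul ((-1) ^ i) (F i)))"
    by (intro sum.cong refl) (use F in \<open>auto simp: cone_cmul nth_Cons' simp del: replicate_Suc\<close>)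
  also have "\<dots> = - cone (\<Sum>i=1..length xs. frag_cmul ((-1) ^ i) (F i))"
    by (simp add: cone_def frag_extend_sum sum_negf comp_def)
  also have "(\<Sum>i=1..length xs. frag_cmul ((-1) ^ i) (F i)) = proj xs - frag_of xs"
    using Cons by (simp add: F_def algebra_simps)
  finally show ?case
    by (simp add: cone_diff)
qed auto

lemma boundary_eq_bd:
  assumes "Poly_Mapping.keys c \<subseteq> tuples X (Suc n)"
  shows "boundary (\<lambda>a b. g b) n c = bd c"
  unfolding boundary_def bd_def
proof (rule frag_extend_eq)
  fix xs assume "xs \<in> Poly_Mapping.keys c"
  then have "xs \<in> tuples X (Suc n)"
    using assms by blast
  then obtain a ys where xs: "xs = a # ys" "ys \<in> tuples X n"
    by (auto simp: tuples_Suc)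
  have len: "length ys = n"
    using xs(2) by (simp add: tuples_def)
  \<comment> \<open>The entries before position \<open>i\<close> are all replaced by
    \<open>g\<close> of the entry there; dropping the head shifts the indices by one.\<close>
  have "face (\<lambda>a b. g b) i xs = replicate i (g (ys ! (i - 1))) @ drop i ys"
    if "i \<in> {1..n}" for i
    using that xs(1) len by (auto simp: face_def map_replicate_const nth_Cons')
  with proj_eq_alternating_sum[OF tuples_listsD[OF xs(2)]] xs(1) len
  show "frag_of (tl xs) + (\<Sum>i=1..n. frag_cmul ((-1) ^ i) (frag_of (face (\<lambda>a b. g b) i xs)))
      = proj (tl xs)"
    by simp
qed


section \<open>Boundaries and cycles in adapted coordinates\<close>

lemma keys_tl:
  "Poly_Mapping.keys c \<subseteq> tuples X (Suc n) \<Longrightarrow>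
    Poly_Mapping.keys (frag_extend (\<lambda>xs. frag_of (tl xs)) c) \<subseteq> tuples X n"
  by (rule keys_frag_extend_subset) (auto simp: tuples_Suc)

lemma bd_eq_proj_tl: "bd c = frag_extend proj (frag_extend (\<lambda>xs. frag_of (tl xs)) c)"
  by (simp add: bd_def frag_extend_frag_extend)

lemma proj_adapted:
  assumes "Poly_Mapping.keys e \<subseteq> lists X"
  shows "frag_extend proj (frag_extend adapted e) =
    frag_extend adapted (frag_extend (\<lambda>xs. if in_image xs then frag_of xs else 0) e)"
  unfolding frag_extend_frag_extend
  by (rule frag_extend_eq) (simp add: proj_adapted_of subsetD[OF assms])

lemma keys_adapted_ext:
  "Poly_Mapping.keys c \<subseteq> tuples X n \<Longrightarrow> Poly_Mapping.keys (frag_extend adapted c) \<subseteq> tuples X n"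
  by (rule keys_frag_extend_subset[OF _ keys_adapted])

lemma keys_coords_ext:
  "Poly_Mapping.keys c \<subseteq> tuples X n \<Longrightarrow> Poly_Mapping.keys (frag_extend coords c) \<subseteq> tuples X n"
  by (rule keys_frag_extend_subset[OF _ keys_coords])

text \<open>In adapted coordinates \<open>proj\<close> is restriction to the indices in
  \<open>in_image\<close>. Conversely, the cone supplies preimages: \<open>bd (cone b) = b\<close>
  whenever \<open>proj\<close> fixes \<open>b\<close>.\<close>

lemma scaled_bd_image:
  assumes "Poly_Mapping.keys c \<subseteq> tuples X n"
  shows "c \<in> (\<lambda>b. frag_cmul d (bd b)) ` {b. Poly_Mapping.keys b \<subseteq> tuples X (Suc n)} \<longleftrightarrow>
    (\<exists>e. Poly_Mapping.keys e \<subseteq> {xs \<in> tuples X n. in_image xs} \<and>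
      frag_extend coords c = frag_cmul d e)"
proof
  assume "c \<in> (\<lambda>b. frag_cmul d (bd b)) ` {b. Poly_Mapping.keys b \<subseteq> tuples X (Suc n)}"
  then obtain b where b: "Poly_Mapping.keys b \<subseteq> tuples X (Suc n)" "c = frag_cmul d (bd b)"
    by blast
  \<comment> \<open>\<open>z\<close> forgets first entries, \<open>w\<close> holds the adapted
    coordinates of \<open>z\<close>, and \<open>e\<close> keeps those on which \<open>proj\<close>
    is the identity.\<close>
  define z where "z = frag_extend (\<lambda>xs. frag_of (tl xs)) b"
  define w where "w = frag_extend coords z"
  define e where "e = frag_extend (\<lambda>xs. if in_image xs then frag_of xs else 0) w"
  have z: "Poly_Mapping.keys z \<subseteq> tuples X n"
    unfolding z_def by (rule keys_tl[OF b(1)])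
  then have w: "Poly_Mapping.keys w \<subseteq> tuples X n"
    unfolding w_def by (rule keys_coords_ext)
  then have e: "Poly_Mapping.keys e \<subseteq> {xs \<in> tuples X n. in_image xs}"
    unfolding e_def by (rule keys_frag_extend_subset) auto
  have "bd b = frag_extend proj (frag_extend adapted w)"
    unfolding w_def adapted_coords[OF keys_lists[OF z]] by (simp add: bd_eq_proj_tl z_def)
  also have "\<dots> = frag_extend adapted e"
    unfolding e_def by (rule proj_adapted[OF keys_lists[OF w]])
  finally have "frag_extend coords c = frag_cmul d (frag_extend coords (frag_extend adapted e))"
    using b by (simp add: frag_extend_cmul)
  also have "frag_extend coords (frag_extend adapted e) = e"
    using e by (intro coords_adapted keys_lists[of _ _ n]) blast
  finally show "\<exists>e. Poly_Mapping.keys e \<subseteq> {xs \<in> tuples X n. in_image xs} \<and>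
      frag_extend coords c = frag_cmul d e"
    using e by blast
next
  assume "\<exists>e. Poly_Mapping.keys e \<subseteq> {xs \<in> tuples X n. in_image xs} \<and>
      frag_extend coords c = frag_cmul d e"
  then obtain e where e: "Poly_Mapping.keys e \<subseteq> {xs \<in> tuples X n. in_image xs}"
      "frag_extend coords c = frag_cmul d e"
    by blast
  then have keys_e: "Poly_Mapping.keys e \<subseteq> tuples X n" by blast
  have "frag_extend proj (frag_extend adapted e) = frag_extend adapted e"
    unfolding proj_adapted[OF keys_lists[OF keys_e]]
    using e(1) by (subst frag_extend_eq_id[of e]) auto
  then have "frag_cmul d (bd (cone (frag_extend adapted e))) = frag_extend adapted (frag_cmul d e)"
    by (simp add: bd_cone frag_extend_cmul)
  also have "\<dots> = c"
    unfolding e(2)[symmetric] by (rule adapted_coords[OF keys_lists[OF assms]])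
  finally show "c \<in> (\<lambda>b. frag_cmul d (bd b)) ` {b. Poly_Mapping.keys b \<subseteq> tuples X (Suc n)}"
    using keys_cone[OF keys_adapted_ext[OF keys_e]] by (intro image_eqI[of c]) auto
qed

text \<open>An index outside \<open>in_kernel\<close> is determined by its tail, so
  \<open>bd\<close> sends the corresponding basis elements to distinct basis elements and no
  cancellation can occur; the other basis elements are killed.\<close>

lemma bd_eq_0_iff:
  assumes "Poly_Mapping.keys c \<subseteq> tuples X (Suc n)"
  shows "bd c = 0 \<longleftrightarrow> Poly_Mapping.keys (frag_extend coords c) \<subseteq> {xs. in_kernel xs}"
proof -
  \<comment> \<open>\<open>R\<close> is \<open>bd\<close> written in adapted coordinates on both
    sides.\<close>
  define R :: "('a list \<Rightarrow>\<^sub>0 int) \<Rightarrow> ('a list \<Rightarrow>\<^sub>0 int)"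
    where "R = frag_extend (\<lambda>xs. if in_kernel xs then 0 else frag_of (tl xs))"
  define e where "e = frag_extend coords c"
  have e: "Poly_Mapping.keys e \<subseteq> tuples X (Suc n)"
    unfolding e_def by (rule keys_coords_ext[OF assms])
  have R: "Poly_Mapping.keys (R e) \<subseteq> tuples X n"
    unfolding R_def by (rule keys_frag_extend_subset[OF e]) (auto simp: tuples_Suc)
  have "bd (frag_extend adapted e) = frag_extend adapted (R e)"
    unfolding bd_def R_def frag_extend_frag_extend
  proof (rule frag_extend_eq)
    fix xs assume "xs \<in> Poly_Mapping.keys e"
    then have "xs \<in> tuples X (Suc n)"
      using e by blast
    then have "xs \<in> lists X" "xs \<noteq> []"
      by (auto simp: tuples_def)
    from bd_adapted_of[OF this]
    show "frag_extend (\<lambda>xs. proj (tl xs)) (adapted xs) =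
      frag_extend adapted (if in_kernel xs then 0 else frag_of (tl xs))"
      by (simp add: bd_def)
  qed
  also have "frag_extend adapted e = c"
    unfolding e_def by (rule adapted_coords[OF keys_lists[OF assms]])
  finally have bd_R: "bd c = 0 \<longleftrightarrow> R e = 0"
    using coords_adapted[OF keys_lists[OF R]] by auto
  \<comment> \<open>Among the indices outside \<open>in_kernel\<close>, only
    \<open>base ys # ys\<close> has tail \<open>ys\<close>, so a single coefficient
    contributes.\<close>
  have lookup_R: "Poly_Mapping.lookup (R e) ys = Poly_Mapping.lookup e (base ys # ys)"
    if "in_image ys" for ys
    using e
  proof (induction e rule: frag_induction)
    case (one xs)
    with that show ?case
      by (auto simp: R_def in_kernel_def tuples_Suc)
  qed (auto simp: R_def frag_extend_diff lookup_minus)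
  have "Poly_Mapping.keys e \<subseteq> {xs. in_kernel xs}" if "R e = 0"
  proof
    fix xs assume xs: "xs \<in> Poly_Mapping.keys e"
    with e have "xs \<in> tuples X (Suc n)"
      by blast
    then obtain a ys where "xs = a # ys"
      by (auto simp: tuples_Suc)
    with lookup_R[of ys] that xs show "xs \<in> {xs. in_kernel xs}"
      by (auto simp: in_kernel_def in_keys_iff)
  qed
  moreover have "R e = 0" if "Poly_Mapping.keys e \<subseteq> {xs. in_kernel xs}"
    unfolding R_def using that by (intro frag_extend_eq_0) auto
  ultimately show ?thesis
    unfolding bd_R e_def by blast
qed

text \<open>All tails are empty in degree 0, so \<open>bd c\<close> is \<open>augmentation c\<close>
  times the empty tuple. This lets degree 0 share the argument for higher degrees.\<close>

lemma augmentation_eq_0_iff: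
  assumes "Poly_Mapping.keys c \<subseteq> tuples X 1"
  shows "augmentation c = 0 \<longleftrightarrow> bd c = 0"
proof -
  have sum: "(\<Sum>i\<in>I. frag_cmul (f i) b) = frag_cmul (sum f I) b"
    for f :: "'a list \<Rightarrow> int" and b :: "'a list \<Rightarrow>\<^sub>0 int" and I
    by (induction I rule: infinite_finite_induct) (auto simp: frag_cmul_distrib)
  have "bd c = frag_extend (\<lambda>_. frag_of []) c"
    unfolding bd_def using assms by (intro frag_extend_eq) (auto simp: tuples_def length_Suc_conv)
  also have "\<dots> = frag_cmul (augmentation c) (frag_of [])"
    unfolding frag_extend_def augmentation_def by (rule sum)
  finally show ?thesis by simp
qed

text \<open>A head moved by \<open>g\<close> differs from \<open>base ys\<close>, which
  \<open>g\<close> fixes; for the head \<open>base ys\<close> both predicates say that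
  \<open>ys\<close> is not in \<open>in_image\<close>. This is the index form of boundaries being
  cycles.\<close>

lemma in_image_imp_in_kernel:
  assumes "xs \<in> tuples X (Suc n)" "in_image xs"
  shows "in_kernel xs"
proof -
  obtain a ys where xs: "xs = a # ys" "ys \<in> tuples X n"
    using assms(1) by (auto simp: tuples_Suc)
  show ?thesis
    using assms(2) g_base_tuples[OF xs(2)] unfolding xs(1) in_kernel_def
    by (metis in_image.simps(2) list.sel(1,3))
qed

section \<open>Counting the basis elements\<close>

lemma g_image: "g ` X = {a \<in> X. g a = a}"
  by (auto simp: g_in g_idem intro: rev_image_eqI)

lemma card_fixed: "finite X \<Longrightarrow> card {a \<in> X. g a \<noteq> a} + card (g ` X) = card X"
  unfolding g_image by (subst card_Un_disjoint[symmetric]) (auto intro: arg_cong[where f = card])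

text \<open>The remaining indices have a head that is fixed by \<open>g\<close> and different from
  \<open>base xs\<close>, so each tail excludes exactly one fixed point.\<close>

lemma card_kernel_minus_image:
  assumes "finite X"
  shows "card ({xs \<in> tuples X (Suc n). in_kernel xs} - {xs \<in> tuples X (Suc n). in_image xs})
    = (card (g ` X) - 1) * card X ^ n"
proof -
  have "{xs \<in> tuples X (Suc n). in_kernel xs} - {xs \<in> tuples X (Suc n). in_image xs}
     = (\<lambda>(xs, a). a # xs) ` (SIGMA xs:tuples X n. g ` X - {base xs})"
    unfolding g_image by (auto simp: tuples_Suc[of X n] in_kernel_def g_base_tuples[of _ n])
  also have "card \<dots> = card (SIGMA xs:tuples X n. g ` X - {base xs})"
    by (rule card_image) (auto simp: inj_on_def)
  also have "\<dots> = (\<Sum>xs\<in>tuples X n. card (g ` X - {base xs}))"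
    using assms by (simp add: finite_tuples)
  also have "\<dots> = (\<Sum>xs\<in>tuples X n. card (g ` X) - 1)"
    using assms unfolding g_image
    by (intro sum.cong refl card_Diff_singleton) (auto simp: base_in_tuples[of _ n] g_base_tuples[of _ n])
  also have "\<dots> = (card (g ` X) - 1) * card X ^ n"
    using assms by (simp add: card_tuples)
  finally show ?thesis .
qed

text \<open>Heads moved by \<open>g\<close> admit every tail, while the head \<open>base xs\<close>
  admits exactly the tails outside \<open>in_image\<close>. Adding the count for length
  \<open>n\<close> avoids subtraction of naturals.\<close>

lemma card_in_image_Suc:
  assumes "finite X"
  shows "card {xs \<in> tuples X (Suc n). in_image xs} + card {xs \<in> tuples X n. in_image xs}
    = card {a \<in> X. g a \<noteq> a} * card X ^ n + card X ^ n"
proof -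
  let ?A = "{a \<in> X. g a \<noteq> a}"
  let ?N = "{xs \<in> tuples X n. \<not> in_image xs}"
  have fin: "finite ?A" "finite ?N" "finite (tuples X n)"
    using assms finite_tuples[OF assms, of n] by auto
  have "{xs \<in> tuples X (Suc n). in_image xs}
      = (\<lambda>(a, xs). a # xs) ` (?A \<times> tuples X n) \<union> (\<lambda>xs. base xs # xs) ` ?N"
    by (auto simp: tuples_Suc[of X n] base_in_tuples[of _ n])
  also have "card \<dots> = card ((\<lambda>(a, xs). a # xs) ` (?A \<times> tuples X n)) +
      card ((\<lambda>xs. base xs # xs) ` ?N)"
    using fin by (intro card_Un_disjoint) (auto simp: g_base_tuples[of _ n])
  also have "card ((\<lambda>(a, xs). a # xs) ` (?A \<times> tuples X n)) = card ?A * card X ^ n"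
    using assms by (subst card_image) (auto simp: inj_on_def card_cartesian_product card_tuples)
  also have "card ((\<lambda>xs. base xs # xs) ` ?N) = card ?N"
    by (rule card_image) (auto simp: inj_on_def)
  finally have "card {xs \<in> tuples X (Suc n). in_image xs} = card ?A * card X ^ n + card ?N" .
  moreover have "card ?N + card {xs \<in> tuples X n. in_image xs} = card (tuples X n)"
    using fin by (subst card_Un_disjoint[symmetric]) (auto intro: arg_cong[where f = card])
  ultimately show ?thesis
    using assms by (simp add: card_tuples)
qed

text \<open>Solving the recursion of \<open>card_in_image_Suc\<close> alternates signs, which
  produces \<open>alt_card_sum\<close>.\<close>

lemma card_in_image:
  assumes "finite X"
  shows "int (card {xs \<in> tuples X (Suc n). in_image xs})
    = int (card X) ^ Suc n - int (card (g ` X)) * alt_card_sum X n"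
proof (induction n)
  have A: "int (card {a \<in> X. g a \<noteq> a}) = int (card X) - int (card (g ` X))"
    using card_fixed[OF assms] by linarith
  {
    \<comment> \<open>The empty tuple is in \<open>in_image\<close>, so the recursion starts from 1
      at length 0.\<close>
    case 0
    have "{xs \<in> tuples X 0. in_image xs} = {[]}"
      by (auto simp: tuples_0)
    then show ?case
      using card_in_image_Suc[OF assms, of 0] A by (simp add: alt_card_sum_def)
  next
    case (Suc n)
    have "int (card {xs \<in> tuples X (Suc (Suc n)). in_image xs}) +
        int (card {xs \<in> tuples X (Suc n). in_image xs})
      = int (card {a \<in> X. g a \<noteq> a}) * int (card X) ^ Suc n + int (card X) ^ Suc n"
      using arg_cong[OF card_in_image_Suc[OF assms, of "Suc n"], of int] by simp
    with Suc show ?case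
      unfolding A alt_card_sum_Suc by (simp add: algebra_simps)
  }
qed


section \<open>Augmented homology for nonzero \<open>d\<close>\<close>

definition cycles :: "nat \<Rightarrow> ('a list \<Rightarrow>\<^sub>0 int) monoid" where
  "cycles n = (chain_group X n)\<lparr>carrier := {c. Poly_Mapping.keys c \<subseteq> tuples X (Suc n) \<and> bd c = 0}\<rparr>"

lemma group_cycles: "group (cycles n)"
proof -
  let ?Z = "{c. Poly_Mapping.keys c \<subseteq> tuples X (Suc n) \<and> bd c = 0}"
  let ?F = "free_Abelian_group (tuples X (Suc n))"
  have "subgroup ?Z ?F"
  proof (rule group.subgroupI)
    show "?Z \<noteq> {}"
      by (auto simp: bd_def intro!: exI[of _ 0])
    show "inv\<^bsub>?F\<^esub> c \<in> ?Z" if "c \<in> ?Z" for c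
      using that by (simp add: bd_def frag_extend_minus)
    show "b \<otimes>\<^bsub>?F\<^esub> c \<in> ?Z" if "b \<in> ?Z" "c \<in> ?Z" for b c
      using that by (simp add: bd_def frag_extend_add keys_add_subset)
  qed auto
  from subgroup.subgroup_is_group[OF this group_free_Abelian_group] show ?thesis
    by (simp add: cycles_def chain_group_eq)
qed

text \<open>By \<open>bd_eq_0_iff\<close>, the adapted basis elements with index in
  \<open>in_kernel\<close> form a basis of the cycles; the inverse map is the extension of
  \<open>adapted\<close>.\<close>

lemma coords_iso_cycles:
  "frag_extend coords \<in>
    iso (cycles n) (free_Abelian_group {xs \<in> tuples X (Suc n). in_kernel xs})"
proof -
  let ?Q = "{xs \<in> tuples X (Suc n). in_kernel xs}"
  let ?Z = "{c. Poly_Mapping.keys c \<subseteq> tuples X (Suc n) \<and> bd c = 0}"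
  have coords: "Poly_Mapping.keys (frag_extend coords c) \<subseteq> ?Q" if "c \<in> ?Z" for c
    using that bd_eq_0_iff[of c n] keys_coords_ext[of c "Suc n"] by blast
  have adapted: "frag_extend adapted e \<in> ?Z" if "Poly_Mapping.keys e \<subseteq> ?Q" for e
  proof -
    have e: "Poly_Mapping.keys e \<subseteq> tuples X (Suc n)" "Poly_Mapping.keys e \<subseteq> {xs. in_kernel xs}"
      using that by auto
    have "Poly_Mapping.keys (frag_extend adapted e) \<subseteq> tuples X (Suc n)"
      using e(1) by (rule keys_adapted_ext)
    with e show ?thesis
      by (simp add: bd_eq_0_iff coords_adapted[OF keys_lists[OF e(1)]])
  qed
  have "bij_betw (frag_extend coords) ?Z {e. Poly_Mapping.keys e \<subseteq> ?Q}"
  proof (rule bij_betw_byWitness[where f' = "frag_extend adapted"])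
    show "\<forall>c\<in>?Z. frag_extend adapted (frag_extend coords c) = c"
      by (simp add: adapted_coords[OF keys_lists[of _ X "Suc n"]])
    show "\<forall>e\<in>{e. Poly_Mapping.keys e \<subseteq> ?Q}. frag_extend coords (frag_extend adapted e) = e"
      using keys_lists[of _ X "Suc n"] by (intro ballI coords_adapted) blast
    show "frag_extend coords ` ?Z \<subseteq> {e. Poly_Mapping.keys e \<subseteq> ?Q}"
      by (intro image_subsetI CollectI) (rule coords)
    show "frag_extend adapted ` {e. Poly_Mapping.keys e \<subseteq> ?Q} \<subseteq> ?Z"
      by (intro image_subsetI adapted) (rule CollectD)
  qed
  moreover have "frag_extend coords \<in> hom (cycles n) (free_Abelian_group ?Q)"
  proof (rule homI)
    show "frag_extend coords c \<in> carrier (free_Abelian_group ?Q)" if "c \<in> carrier (cycles n)" for c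
      using coords[of c] that by (simp add: cycles_def)
  qed (simp add: cycles_def chain_group_eq frag_extend_add)
  ultimately show ?thesis
    by (simp add: iso_def cycles_def free_Abelian_group_def)
qed

lemma augmented_homology_eq:
  assumes "d \<noteq> 0"
  shows "augmented_homology d (\<lambda>a b. g b) X n = cycles n Mod
    {c \<in> carrier (cycles n). \<exists>e. Poly_Mapping.keys e \<subseteq> {xs \<in> tuples X (Suc n). in_image xs} \<and>
      frag_extend coords c = frag_cmul d e}"
proof -
  have scaled: "scaled_boundary d (\<lambda>a b. g b) m c = frag_cmul d (bd c)"
    if "Poly_Mapping.keys c \<subseteq> tuples X (Suc m)" for m c
    using that by (simp add: scaled_boundary_def boundary_eq_bd)
  have im: "scaled_boundary d (\<lambda>a b. g b) (Suc n) ` carrier (chain_group X (Suc n)) =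
    {c \<in> carrier (cycles n). \<exists>e. Poly_Mapping.keys e \<subseteq> {xs \<in> tuples X (Suc n). in_image xs} \<and>
      frag_extend coords c = frag_cmul d e}"
    (is "_ = ?N")
  proof -
    have "scaled_boundary d (\<lambda>a b. g b) (Suc n) ` carrier (chain_group X (Suc n)) =
      (\<lambda>b. frag_cmul d (bd b)) ` {b. Poly_Mapping.keys b \<subseteq> tuples X (Suc (Suc n))}"
      by (rule image_cong) (auto simp: chain_group_eq scaled)
    also have "\<dots> = ?N"
    proof (intro subset_antisym subsetI)
      fix c assume c: "c \<in> (\<lambda>b. frag_cmul d (bd b)) ` {b. Poly_Mapping.keys b \<subseteq> tuples X (Suc (Suc n))}"
      have keys: "Poly_Mapping.keys c \<subseteq> tuples X (Suc n)"
      proof -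
        obtain b where b: "c = frag_cmul d (bd b)" "Poly_Mapping.keys b \<subseteq> tuples X (Suc (Suc n))"
          using c by blast
        have "Poly_Mapping.keys (bd b) \<subseteq> tuples X (Suc n)"
          unfolding bd_def
          by (rule keys_frag_extend_subset[OF b(2)]) (auto simp: tuples_Suc[of X "Suc n"] intro: keys_proj[THEN subsetD])
        with b show ?thesis using keys_cmul by blast
      qed
      from c obtain e where e: "Poly_Mapping.keys e \<subseteq> {xs \<in> tuples X (Suc n). in_image xs}"
          "frag_extend coords c = frag_cmul d e"
        unfolding scaled_bd_image[OF keys] by blast
      \<comment> \<open>Multiplying by \<open>d\<close> cannot enlarge the support, so the
        coordinates of \<open>c\<close> stay on image indices, which are cycle indices.\<close>
      have "Poly_Mapping.keys (frag_extend coords c) \<subseteq> Poly_Mapping.keys e"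
        unfolding e(2) by (rule keys_cmul)
      with e(1) have "Poly_Mapping.keys (frag_extend coords c) \<subseteq> {xs. in_kernel xs}"
        using in_image_imp_in_kernel by blast
      then have "bd c = 0"
        using bd_eq_0_iff[OF keys] by simp
      with e keys show "c \<in> ?N"
        by (auto simp: cycles_def)
    next
      fix c assume "c \<in> ?N"
      then show "c \<in> (\<lambda>b. frag_cmul d (bd b)) ` {b. Poly_Mapping.keys b \<subseteq> tuples X (Suc (Suc n))}"
        by (subst scaled_bd_image) (auto simp: cycles_def)
    qed
    finally show ?thesis .
  qed
  show ?thesis
  proof (cases n)
    case 0
    \<comment> \<open>In degree 0 the condition \<open>bd c = 0\<close> stands for vanishing
      augmentation.\<close>
    have "kernel (chain_group X 0) integer_group augmentation
        = {c. Poly_Mapping.keys c \<subseteq> tuples X (Suc 0) \<and> bd c = 0}"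
      by (auto simp: kernel_def chain_group_eq augmentation_eq_0_iff)
    with 0 im show ?thesis
      by (simp add: homology_at_def cycles_def)
  next
    case (Suc m)
    \<comment> \<open>Chain groups are torsion-free, so a nonzero factor \<open>d\<close> does not
      change the kernel.\<close>
    have "kernel (chain_group X (Suc m)) (chain_group X m) (scaled_boundary d (\<lambda>a b. g b) (Suc m))
        = {c. Poly_Mapping.keys c \<subseteq> tuples X (Suc (Suc m)) \<and> bd c = 0}"
      using assms by (auto simp: kernel_def chain_group_eq scaled)
    with Suc im show ?thesis
      by (simp add: homology_at_def cycles_def)
  qed
qed

lemma augmented_homology_iso:
  assumes "finite X" "d \<noteq> 0"
  shows "augmented_homology d (\<lambda>a b. g b) X n \<cong>
    group_power integer_group ((card (g ` X) - 1) * card X ^ n) \<times>\<times>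
    group_power (int_mod d) (nat (int (card X) ^ (n + 1) - int (card (g ` X)) * alt_card_sum X n))"
proof -
  let ?Q = "{xs \<in> tuples X (Suc n). in_kernel xs}"
  let ?E = "{xs \<in> tuples X (Suc n). in_image xs}"
  have "finite ?Q"
    using finite_tuples[OF assms(1)] by simp
  moreover have "?E \<subseteq> ?Q"
    using in_image_imp_in_kernel by blast
  ultimately show ?thesis
    using free_Abelian_group_quotient_iso[OF group_cycles coords_iso_cycles, of n ?E d]
      \<comment> \<open>Reversed, this equation turns the exponent under \<open>nat\<close> into the
        cardinality of \<open>?E\<close>.\<close>
      card_in_image[OF assms(1), of n, symmetric]
    by (simp add: augmented_homology_eq[OF assms(2)] card_kernel_minus_image[OF assms(1)])
qed

end

section \<open>The case \<open>d = 0\<close> and the conclusion\<close>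

lemma homology_zero_iso:
  "r_coset (chain_group X n) (scaled_boundary 0 star (n + 1) ` carrier (chain_group X (n + 1)))
    \<in> iso (chain_group X n) (homology 0 star X n)"
proof -
  have group: "group (chain_group X m)" for m
    by (simp add: chain_group_eq)
  have one: "\<one>\<^bsub>chain_group X m\<^esub> = 0" for m
    by (simp add: chain_group_eq)
  have zero: "scaled_boundary 0 star m = (\<lambda>_. 0)" for m
    by (simp add: scaled_boundary_def fun_eq_iff)
  have "0 \<in> carrier (chain_group X m)" for m
    by (simp add: chain_group_eq)
  then have im: "scaled_boundary 0 star m ` carrier (chain_group X k) = {0}" for m k
    unfolding zero by (rule image_constant)
  have ker: "kernel (chain_group X m) (chain_group X k) (scaled_boundary 0 star m)
      = carrier (chain_group X m)" for m k
    by (simp add: kernel_def zero one)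
  \<comment> \<open>Every chain is a cycle, also in degree 0, where the outgoing map ends in the
    trivial group; the only boundary is 0.\<close>
  have "homology 0 star X n = chain_group X n Mod {0}"
    by (cases n) (simp_all add: homology_at_def im ker kernel_def[of _ "singleton_group ()"])
  with group.r_coset_one_iso[OF group, of n] show ?thesis
    by (simp only: im one)
qed

theorem corollary6p7:
  fixes X :: "'a set" and g :: "'a \<Rightarrow> 'a" and d :: int
  assumes "finite X" and "X \<noteq> {}"
    and "g \<in> X \<rightarrow> X" and "\<And>x. x \<in> X \<Longrightarrow> g (g x) = g x"
  shows
    "(d \<noteq> 0 \<longrightarrow>
       (\<forall>n. augmented_homology d (\<lambda>a b. g b) X n \<cong>
          group_power integer_group ((card (g ` X) - 1) * card X ^ n) \<times>\<times>
          group_power (int_mod d)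
            (nat (int (card X) ^ (n + 1) - int (card (g ` X)) * alt_card_sum X n))) \<and>
       ((\<forall>x\<in>X. g x = x) \<longrightarrow>
         (\<forall>n. augmented_homology d (\<lambda>a b. g b) X n \<cong>
            group_power integer_group ((card X - 1) * card X ^ n) \<times>\<times>
            group_power (int_mod d) (nat (alt_card_sum X n - (-1) ^ n))))) \<and>
     (d = 0 \<longrightarrow>
       (\<forall>n. r_coset (chain_group X n)
              (scaled_boundary d (\<lambda>a b. g b) (n + 1) ` carrier (chain_group X (n + 1)))
              \<in> iso (chain_group X n) (homology d (\<lambda>a b. g b) X n) \<and>
            chain_group X n \<cong> group_power integer_group (card X ^ (n + 1))))"
proof -
  obtain x where x: "x \<in> X"
    using assms(2) by blast
  \<comment> \<open>By idempotence \<open>g x\<close> is a fixed point of \<open>g\<close>, as the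
    cone over the empty tuple requires.\<close>
  interpret idempotent_map X g "g x"
    by unfold_locales (use assms x in auto)
  show ?thesis
  proof (intro conjI impI allI)
    fix n assume d: "d \<noteq> 0"
    show iso: "augmented_homology d (\<lambda>a b. g b) X n \<cong>
        group_power integer_group ((card (g ` X) - 1) * card X ^ n) \<times>\<times>
        group_power (int_mod d) (nat (int (card X) ^ (n + 1) - int (card (g ` X)) * alt_card_sum X n))"
      by (rule augmented_homology_iso[OF assms(1) d])
    assume "\<forall>x\<in>X. g x = x"
    then have "g ` X = X" by auto
    \<comment> \<open>For the identity the two forms of the torsion exponent agree, by induction
      with \<open>alt_card_sum_Suc\<close>.\<close>
    moreover have "int (card X) ^ (n + 1) - int (card X) * alt_card_sum X n = alt_card_sum X n - (-1) ^ n"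
    proof (induction n)
      case (Suc n)
      then show ?case
        unfolding alt_card_sum_Suc by (simp add: algebra_simps)
    qed (simp add: alt_card_sum_def)
    ultimately show "augmented_homology d (\<lambda>a b. g b) X n \<cong>
        group_power integer_group ((card X - 1) * card X ^ n) \<times>\<times>
        group_power (int_mod d) (nat (alt_card_sum X n - (-1) ^ n))"
      using iso by simp
  next
    fix n assume "d = 0"
    then show "r_coset (chain_group X n)
        (scaled_boundary d (\<lambda>a b. g b) (n + 1) ` carrier (chain_group X (n + 1)))
        \<in> iso (chain_group X n) (homology d (\<lambda>a b. g b) X n)"
      using homology_zero_iso[of X n "\<lambda>a b. g b"] by simp
  next
    fix n
    show "chain_group X n \<cong> group_power integer_group (card X ^ (n + 1))"
      using free_Abelian_group_iso_group_power[OF finite_tuples[OF assms(1)], of "Suc n"]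
      by (simp add: chain_group_eq card_tuples[OF assms(1)])
  qed
qed

end
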